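(* Let $\tilde\kappa_1,\dots,\tilde\kappa_n>0$ be fixed and consider $$\min_{\boldsymbol{g}\in\mathbb{R}_{\ge0}^n}\ \mathrm{P}_e(\tilde{\boldsymbol{\kappa}},\boldsymbol{g})\quad\text{s.t.}\quad\sum_{i=1}^n\xi_ig_i^2\le\mathcal{P}_{\mathrm{tot}},$$ with $\mathrm{P}_e$ as defined in the context; equivalently, with $z_i=g_i^2$, $a_i=\tilde\kappa_i\gamma_i^2$, $b_i=\tilde\kappa_i\tilde\sigma_v^2/|h_i|^2$, $$\min_{\boldsymbol{z}}\ \sum_{i=1}^n\frac{a_ib_i}{z_i+b_i}\quad\text{s.t.}\quad\sum_{i=1}^n\xi_iz_i\le\mathcal{P}_{\mathrm{tot}},\ z_i\ge0.$$ Let $\beta_i=\sqrt{b_i\xi_i/a_i}$, assume $\beta_1\le\beta_2\le\cdots\le\beta_n$, and put $$f(i)=\frac{\beta_i\sum_{j=1}^i\sqrt{a_jb_j\xi_j}}{\mathcal{P}_{\mathrm{tot}}+\sum_{j=1}^ib_j\xi_j},\qquad 1\le i\le n.$$ Let $\mathcal{S}_0=\{1,\dots,n\}$ if $f(n)<1$, and otherwise $\mathcal{S}_0=\{1,\dots,i_{\mathcal{S}}\}$, where $i_{\mathcal{S}}$ is the index with $f(i_{\mathcal{S}})<1$ and $f(i_{\mathcal{S}}+1)\ge1$. Then the optimal amplifier gains are $$g_i=\left[\frac{\tilde\kappa_i\tilde\sigma_v^2}{|h_i|^2}\left(\frac{\gamma_i|h_i|}{\sqrt{\xi_i}}\,\eta-1\right)\right]^{1/2}\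 \ (i\in\mathcal{S}_0),\qquad g_i=0\ \ (i\notin\mathcal{S}_0),$$ where $$\eta=\frac{\sum_{i\in\mathcal{S}_0}\tilde\kappa_i\xi_i/|h_i|^2+\mathcal{P}_{\mathrm{tot}}/\tilde\sigma_v^2}{\sum_{i\in\mathcal{S}_0}\tilde\kappa_i\sqrt{\xi_i}\,\gamma_i/|h_i|}.$$
   Context: Let $n\ge1$ be the number of secondary users. For each $i\in\{1,\dots,n\}$, $\gamma_i>0$ is the local received SNR and $h_i\in\mathbb{C}\setminus\{0\}$ the fusion channel gain. Let $\sigma_n^2,\sigma_v^2>0$ be noise variances, $\tilde\sigma_v^2=\sigma_v^2/\sigma_n^4$ with $\tilde\sigma_v>0$, and let $\mathcal{P}_{\mathrm{tot}}>0$ be the global transmission power budget. Put $\xi_i=(1+2\pi_1\gamma_i)\sigma_n^4>0$ with $\pi_1=1/2$. For numbers of samples $\tilde{\boldsymbol{\kappa}}=(\tilde\kappa_1,\dots,\tilde\kappa_n)$ and amplifier gains $\boldsymbol{g}=(g_1,\dots,g_n)$, the error probability is $$\mathrm{P}_e(\tilde{\boldsymbol{\kappa}},\boldsymbol{g})=Q\left(\frac12\Big(\sum_{i=1}^n\frac{g_i^2\tilde\kappa_i\gamma_i^2|h_i|^2}{g_i^2|h_i|^2+\tilde\kappa_i\tilde\sigma_v^2}\Big)^{1/2}\right),\qquad Q(x)=\frac1{\sqrt{2\pi}}\int_x^\infty e^{-t^2/2}\,dt.$$ *)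

theory Defs
  imports "HOL-Analysis.Analysis"
begin

text \<open>
  A vector in n-dimensional real space is a function on the natural numbers of which only the
  values at the indices \<open>1, \<dots>, n\<close> are ever used.
\<close>

definition Q :: "real \<Rightarrow> real" where
  "Q x = 1 / sqrt (2 * pi) * (LBINT t:{x..}. exp (- (t\<^sup>2) / 2))"

text \<open>The argument \<open>s\<close> below is the normalised noise level: its square is the noise variance
  of the fusion channel divided by the squared local noise variance.\<close>

definition error_prob ::
  "nat \<Rightarrow> (nat \<Rightarrow> real) \<Rightarrow> (nat \<Rightarrow> complex) \<Rightarrow> real \<Rightarrow> (nat \<Rightarrow> real) \<Rightarrow> (nat \<Rightarrow> real) \<Rightarrow> real" where
  "error_prob n \<gamma> h s \<kappa> g =
     Q (1 / 2 * sqrt (\<Sum>i=1..n.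
          (g i)\<^sup>2 * \<kappa> i * (\<gamma> i)\<^sup>2 * (cmod (h i))\<^sup>2 / ((g i)\<^sup>2 * (cmod (h i))\<^sup>2 + \<kappa> i * s\<^sup>2)))"

definition gain_feasible :: "nat \<Rightarrow> (nat \<Rightarrow> real) \<Rightarrow> real \<Rightarrow> (nat \<Rightarrow> real) \<Rightarrow> bool" where
  "gain_feasible n \<xi> P g \<longleftrightarrow> (\<forall>i\<in>{1..n}. g i \<ge> 0) \<and> (\<Sum>i=1..n. \<xi> i * (g i)\<^sup>2) \<le> P"

definition alloc_objective ::
  "nat \<Rightarrow> (nat \<Rightarrow> real) \<Rightarrow> (nat \<Rightarrow> real) \<Rightarrow> (nat \<Rightarrow> real) \<Rightarrow> real" where
  "alloc_objective n a b z = (\<Sum>i=1..n. a i * b i / (z i + b i))"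

definition alloc_feasible :: "nat \<Rightarrow> (nat \<Rightarrow> real) \<Rightarrow> real \<Rightarrow> (nat \<Rightarrow> real) \<Rightarrow> bool" where
  "alloc_feasible n \<xi> P z \<longleftrightarrow> (\<Sum>i=1..n. \<xi> i * z i) \<le> P \<and> (\<forall>i\<in>{1..n}. z i \<ge> 0)"

definition is_switch_index :: "nat \<Rightarrow> (nat \<Rightarrow> real) \<Rightarrow> nat \<Rightarrow> bool" where
  "is_switch_index n f i \<longleftrightarrow> 1 \<le> i \<and> i < n \<and> f i < 1 \<and> f (i + 1) \<ge> 1"

definition active_set :: "nat \<Rightarrow> (nat \<Rightarrow> real) \<Rightarrow> nat set" where
  "active_set n f = (if f n < 1 then {1..n} else {1..(THE i. is_switch_index n f i)})"

end

theory Submission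
  imports Defs "HOL-Probability.Distributions"
begin

text \<open>
  In terms of \<open>z\<^sub>i = g\<^sub>i\<^sup>2\<close> the argument of \<open>Q\<close> is half the square root of
  \<open>(\<Sum>i. a\<^sub>i) - (\<Sum>i. a\<^sub>i b\<^sub>i / (z\<^sub>i + b\<^sub>i))\<close>, and \<open>Q\<close> is strictly decreasing, so both problems have
  the same minimisers.  With the multiplier \<open>1 / \<mu>\<^sup>2\<close> for the power constraint the Lagrangian
  splits into one-dimensional problems, each with the unique minimiser
  \<open>max 0 (b\<^sub>i (\<mu> / \<beta>\<^sub>i - 1))\<close>; if these use up exactly the power \<open>P\<close>, they form the
  unique minimiser of the constrained problem.  Finally \<open>f i < 1\<close> means
  \<open>(\<Sum>j\<le>i. \<surd>(a\<^sub>j b\<^sub>j \<xi>\<^sub>j) (\<beta>\<^sub>i - \<beta>\<^sub>j)) < P\<close>, whose left-hand side increases with \<open>i\<close>; the switch index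
  thus separates the \<open>\<beta>\<^sub>i < \<mu>\<close> from the \<open>\<beta>\<^sub>i \<ge> \<mu>\<close> for the level \<open>\<mu>\<close> that spends the power \<open>P\<close>.
\<close>

section \<open>Monotonicity of the Gaussian tail\<close>

lemma set_integrable_gauss:
  assumes "A \<in> sets borel"
  shows "set_integrable lborel A (\<lambda>t::real. exp (- (t\<^sup>2) / 2))"
proof -
  have "integrable lborel (\<lambda>t. sqrt (2 * pi) * std_normal_density t)"
    by (intro integrable_mult_right integrable_normal_density) simp
  hence "integrable lborel (\<lambda>t::real. exp (- (t\<^sup>2) / 2))"
    by (simp add: std_normal_density_def)
  hence "set_integrable lborel UNIV (\<lambda>t::real. exp (- (t\<^sup>2) / 2))"
    by (simp add: set_integrable_def)
  thus ?thesis
    using assms by (rule_tac set_integrable_subset) auto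
qed

text \<open>The two tails differ by the integral over \<open>{x..<y}\<close>, which is at least the
  length \<open>y - x\<close> times a positive lower bound of the integrand.\<close>

lemma Q_strict_antimono:
  assumes "x < y"
  shows "Q y < Q x"
proof -
  let ?e = "\<lambda>t::real. exp (- (t\<^sup>2) / 2)"
  \<comment> \<open>The integrand decreases in the absolute value of \<open>t\<close>, so its value
    at the endpoint farther from 0 bounds it from below on the interval.\<close>
  define m where "m = exp (- ((max \<bar>x\<bar> \<bar>y\<bar>)\<^sup>2) / 2)"
  have split: "{x..} = {x..<y} \<union> {y..}"
    using assms by auto
  have "(LBINT t:{x..}. ?e t) = (LBINT t:{x..<y}. ?e t) + (LBINT t:{y..}. ?e t)"
    unfolding split by (intro set_integral_Un set_integrable_gauss) auto
  moreover have "0 < (LBINT t:{x..<y}. ?e t)"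
  proof -
    have "0 < (y - x) * m"
      using assms by (simp add: m_def)
    also have "\<dots> = (LBINT t:{x..<y}. m)"
      using assms by (simp add: set_lebesgue_integral_def)
    also have "\<dots> \<le> (LBINT t:{x..<y}. ?e t)"
    proof (rule set_integral_mono)
      fix t assume "t \<in> {x..<y}"
      hence "\<bar>t\<bar> \<le> max \<bar>x\<bar> \<bar>y\<bar>"
        by auto
      hence "t\<^sup>2 \<le> (max \<bar>x\<bar> \<bar>y\<bar>)\<^sup>2"
        by (metis abs_ge_zero power2_abs power_mono)
      thus "m \<le> ?e t"
        by (simp add: m_def)
    next
      show "set_integrable lborel {x..<y} (\<lambda>t. m)"
        using assms by (simp add: set_integrable_def)
    qed (rule set_integrable_gauss, simp)
    finally show ?thesis .
  qed
  ultimately have "(LBINT t:{y..}. ?e t) < (LBINT t:{x..}. ?e t)"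
    by simp
  thus ?thesis
    unfolding Q_def by (intro mult_strict_left_mono) auto
qed

lemma Q_less_iff: "Q x < Q y \<longleftrightarrow> y < x"
  using Q_strict_antimono by (metis less_irrefl less_trans linorder_neqE)

section \<open>Passage from gains to powers\<close>

lemma alloc_objective_cong:
  "(\<And>i. i \<in> {1..n} \<Longrightarrow> z i = z' i) \<Longrightarrow> alloc_objective n a b z = alloc_objective n a b z'"
  by (auto simp: alloc_objective_def intro!: sum.cong)

lemma alloc_feasible_cong:
  "(\<And>i. i \<in> {1..n} \<Longrightarrow> z i = z' i) \<Longrightarrow> alloc_feasible n \<xi> P z \<longleftrightarrow> alloc_feasible n \<xi> P z'"
  unfolding alloc_feasible_def by (metis (no_types, lifting) sum.cong)

lemma gain_feasible_iff:
  "gain_feasible n \<xi> P g \<longleftrightarrow>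
     (\<forall>i\<in>{1..n}. g i \<ge> 0) \<and> alloc_feasible n \<xi> P (\<lambda>i. (g i)\<^sup>2)"
  by (auto simp: gain_feasible_def alloc_feasible_def)

text \<open>Dividing numerator and denominator by the squared channel modulus turns each summand
  into \<open>a i * z / (z + b i) = a i - a i * b i / (z + b i)\<close> with
  \<open>z = (g i)\<^sup>2\<close>. The sum of the \<open>a i\<close> does not depend on the gains,
  and \<open>sqrt\<close> is strictly increasing on all of the reals in HOL.\<close>

lemma error_prob_less_iff:
  assumes "\<forall>i\<in>{1..n}. \<kappa> i > 0" "\<forall>i\<in>{1..n}. h i \<noteq> 0" "s > 0"
    and a: "a = (\<lambda>i. \<kappa> i * (\<gamma> i)\<^sup>2)" and b: "b = (\<lambda>i. \<kappa> i * s\<^sup>2 / (cmod (h i))\<^sup>2)"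
  shows "error_prob n \<gamma> h s \<kappa> g < error_prob n \<gamma> h s \<kappa> g' \<longleftrightarrow>
           alloc_objective n a b (\<lambda>i. (g i)\<^sup>2) < alloc_objective n a b (\<lambda>i. (g' i)\<^sup>2)"
proof -
  have *: "(\<Sum>i=1..n. (g i)\<^sup>2 * \<kappa> i * (\<gamma> i)\<^sup>2 * (cmod (h i))\<^sup>2 / ((g i)\<^sup>2 * (cmod (h i))\<^sup>2 + \<kappa> i * s\<^sup>2))
      = sum a {1..n} - alloc_objective n a b (\<lambda>i. (g i)\<^sup>2)" for g :: "nat \<Rightarrow> real"
    unfolding alloc_objective_def sum_subtractf [symmetric]
  proof (rule sum.cong)
    fix i assume i: "i \<in> {1..n}"
    define H where "H = (cmod (h i))\<^sup>2"
    have "H > 0" "\<kappa> i * s\<^sup>2 > 0"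
      using assms i by (auto simp: H_def)
    moreover from this have "(g i)\<^sup>2 * H + \<kappa> i * s\<^sup>2 > 0" "(g i)\<^sup>2 + \<kappa> i * s\<^sup>2 / H > 0"
      by (auto intro!: add_nonneg_pos)
    ultimately show "(g i)\<^sup>2 * \<kappa> i * (\<gamma> i)\<^sup>2 * (cmod (h i))\<^sup>2 / ((g i)\<^sup>2 * (cmod (h i))\<^sup>2 + \<kappa> i * s\<^sup>2)
        = a i - a i * b i / ((g i)\<^sup>2 + b i)"
      unfolding a b H_def [symmetric] by (simp add: divide_simps) (simp add: algebra_simps)
  qed simp
  show ?thesis
    unfolding error_prob_def Q_less_iff * by simp
qed

text \<open>Squaring maps the feasible gains onto the feasible powers, up to values outside
  \<open>{1..n}\<close>, and the order of the objective values is preserved. A better competitor on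
  one side therefore yields one on the other.\<close>

lemma is_arg_min_error_prob_iff:
  assumes "\<forall>i\<in>{1..n}. \<kappa> i > 0" "\<forall>i\<in>{1..n}. h i \<noteq> 0" "s > 0"
    and a: "a = (\<lambda>i. \<kappa> i * (\<gamma> i)\<^sup>2)" and b: "b = (\<lambda>i. \<kappa> i * s\<^sup>2 / (cmod (h i))\<^sup>2)"
    and g: "\<forall>i\<in>{1..n}. g i \<ge> 0"
  shows "is_arg_min (error_prob n \<gamma> h s \<kappa>) (gain_feasible n \<xi> P) g \<longleftrightarrow>
           is_arg_min (alloc_objective n a b) (alloc_feasible n \<xi> P) (\<lambda>i. (g i)\<^sup>2)"
proof -
  note less = error_prob_less_iff [OF assms(1-5)]
  have "(\<exists>g'. gain_feasible n \<xi> P g' \<and> error_prob n \<gamma> h s \<kappa> g' < error_prob n \<gamma> h s \<kappa> g) \<longleftrightarrow>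
        (\<exists>z. alloc_feasible n \<xi> P z \<and> alloc_objective n a b z < alloc_objective n a b (\<lambda>i. (g i)\<^sup>2))"
    (is "?L \<longleftrightarrow> ?R")
  proof
    assume ?L
    thus ?R
      unfolding less gain_feasible_iff by blast
  next
    assume ?R
    then obtain z where z: "alloc_feasible n \<xi> P z"
      "alloc_objective n a b z < alloc_objective n a b (\<lambda>i. (g i)\<^sup>2)"
      by blast
    \<comment> \<open>Outside \<open>{1..n}\<close> the vector \<open>z\<close> may be negative,
      where squaring the root does not give it back; the congruence lemmas bridge this.\<close>
    have sq: "(sqrt (z i))\<^sup>2 = z i" "sqrt (z i) \<ge> 0" if "i \<in> {1..n}" for i
      using z(1) that by (auto simp: alloc_feasible_def)
    have "gain_feasible n \<xi> P (\<lambda>i. sqrt (z i))"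
      using z(1) sq alloc_feasible_cong [of n "\<lambda>i. (sqrt (z i))\<^sup>2" z \<xi> P]
      by (simp add: gain_feasible_iff)
    moreover have "error_prob n \<gamma> h s \<kappa> (\<lambda>i. sqrt (z i)) < error_prob n \<gamma> h s \<kappa> g"
      using z(2) sq alloc_objective_cong [of n "\<lambda>i. (sqrt (z i))\<^sup>2" z a b]
      by (simp add: less)
    ultimately show ?L
      by blast
  qed
  thus ?thesis
    using g by (simp add: is_arg_min_def gain_feasible_iff)
qed

section \<open>Minimising the Lagrangian\<close>

text \<open>For \<open>r < 1\<close>, completing the square gives the value
  \<open>2 * r - r\<^sup>2\<close> plus a square over \<open>1 + w\<close> that vanishes only at
  \<open>1 + w = 1 / r\<close>. For \<open>r \<ge> 1\<close> the minimum is at the boundary: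
  \<open>1 / (1 + w) + w\<close> already exceeds 1 for \<open>w > 0\<close>.\<close>

lemma lagrangian_unit_minimiser:
  fixes r w :: real
  assumes "r > 0" "w \<ge> 0" "w \<noteq> max 0 (1 / r - 1)"
  shows "1 / (1 + max 0 (1 / r - 1)) + r\<^sup>2 * max 0 (1 / r - 1) < 1 / (1 + w) + r\<^sup>2 * w"
proof (cases "r < 1")
  case True
  have "(1 - r * (1 + w)) \<noteq> 0"
    using assms True by (auto simp: max_def field_simps)
  hence "0 < (1 - r * (1 + w))\<^sup>2 / (1 + w)"
    using assms by simp
  also have "\<dots> = 1 / (1 + w) + r\<^sup>2 * w - (2 * r - r\<^sup>2)"
    using assms by (simp add: field_simps power2_eq_square)
  also have "2 * r - r\<^sup>2 = 1 / (1 + (1 / r - 1)) + r\<^sup>2 * (1 / r - 1)"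
    using assms by (simp add: right_diff_distrib power2_eq_square)
  finally show ?thesis
    using assms True by (simp add: max_def)
next
  case False
  hence m: "max 0 (1 / r - 1) = 0"
    using assms by (simp add: field_simps)
  hence w: "w > 0"
    using assms by simp
  have "r\<^sup>2 \<ge> 1"
    using False by (simp add: one_le_power)
  hence "w * 1 \<le> r\<^sup>2 * w"
    using w by simp
  moreover have "1 < 1 / (1 + w) + w"
    using w by (simp add: field_simps)
  ultimately show ?thesis
    by (simp add: m)
qed

text \<open>The substitution \<open>z = b * w\<close> with \<open>r = \<beta> / \<mu>\<close> makes
  the Lagrangian term \<open>a\<close> times the normalised function of the previous lemma.\<close>

lemma lagrangian_minimiser:
  fixes a b \<xi> \<mu> z \<beta> zs :: real
  assumes pos: "a > 0" "b > 0" "\<xi> > 0" "\<mu> > 0" and z: "z \<ge> 0"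
    and \<beta>: "\<beta> = sqrt (b * \<xi> / a)" and zs: "zs = max 0 (b * (\<mu> / \<beta> - 1))"
    and ne: "z \<noteq> zs"
  shows "a * b / (zs + b) + \<xi> * zs / \<mu>\<^sup>2 < a * b / (z + b) + \<xi> * z / \<mu>\<^sup>2"
proof -
  define r where "r = \<beta> / \<mu>"
  have \<beta>0: "\<beta> > 0" and \<beta>2: "\<beta>\<^sup>2 = b * \<xi> / a"
    using pos by (auto simp: \<beta>)
  have r: "r > 0" "1 / r = \<mu> / \<beta>"
    using \<beta>0 pos by (auto simp: r_def)
  have r2: "r\<^sup>2 = b * \<xi> / (a * \<mu>\<^sup>2)"
    by (simp add: r_def power_divide \<beta>2)
  have scale: "a * b / (b * w + b) + \<xi> * (b * w) / \<mu>\<^sup>2 = a * (1 / (1 + w) + r\<^sup>2 * w)"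
    if "w \<ge> 0" for w
  proof -
    have "b * w + b = b * (1 + w)"
      by (simp add: algebra_simps)
    hence "a * b / (b * w + b) = a * (1 / (1 + w))"
      using pos by simp
    moreover have "\<xi> * (b * w) / \<mu>\<^sup>2 = a * (r\<^sup>2 * w)"
      using pos by (simp add: r2)
    ultimately show ?thesis
      by (simp only: distrib_left)
  qed
  have zsw: "zs = b * max 0 (1 / r - 1)"
    using pos by (simp add: zs r(2) max_mult_distrib_left)
  have zw: "z = b * (z / b)"
    using pos by simp
  have "z / b \<noteq> max 0 (1 / r - 1)"
    using ne pos zsw zw by metis
  hence "a * (1 / (1 + max 0 (1 / r - 1)) + r\<^sup>2 * max 0 (1 / r - 1))
      < a * (1 / (1 + z / b) + r\<^sup>2 * (z / b))"
    using lagrangian_unit_minimiser [of r "z / b"] r pos z by simp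
  thus ?thesis
    using scale [of "max 0 (1 / r - 1)"] scale [of "z / b"] pos z unfolding zsw by simp
qed

text \<open>Duality: a feasible \<open>z\<close> differing from \<open>zs\<close> at some index in
  \<open>{1..n}\<close> has a strictly larger Lagrangian. Its power term is at most
  \<open>P / \<mu>\<^sup>2\<close>, the value attained by \<open>zs\<close>, so the strict gap must
  lie in the objective.\<close>

lemma alloc_minimiser_iff:
  fixes a b \<xi> \<beta> zs z :: "nat \<Rightarrow> real"
  assumes pos: "\<And>i. i \<in> {1..n} \<Longrightarrow> a i > 0" "\<And>i. i \<in> {1..n} \<Longrightarrow> b i > 0"
      "\<And>i. i \<in> {1..n} \<Longrightarrow> \<xi> i > 0" "\<mu> > 0"
    and \<beta>: "\<And>i. i \<in> {1..n} \<Longrightarrow> \<beta> i = sqrt (b i * \<xi> i / a i)"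
    and zs: "\<And>i. i \<in> {1..n} \<Longrightarrow> zs i = max 0 (b i * (\<mu> / \<beta> i - 1))"
    and P: "(\<Sum>i=1..n. \<xi> i * zs i) = P"
  shows "is_arg_min (alloc_objective n a b) (alloc_feasible n \<xi> P) z \<longleftrightarrow> (\<forall>i\<in>{1..n}. z i = zs i)"
proof -
  let ?F = "alloc_objective n a b"
  have feas: "alloc_feasible n \<xi> P zs"
    using P zs by (simp add: alloc_feasible_def)
  have strict: "?F zs < ?F z" if z: "alloc_feasible n \<xi> P z" and k: "k \<in> {1..n}" "z k \<noteq> zs k" for z k
  proof -
    let ?L = "\<lambda>z i. a i * b i / (z i + b i) + \<xi> i * z i / \<mu>\<^sup>2"
    have z0: "z i \<ge> 0" if "i \<in> {1..n}" for i
      using z that by (auto simp: alloc_feasible_def)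
    have lt: "?L zs i < ?L z i" if "i \<in> {1..n}" "z i \<noteq> zs i" for i
      using that by (intro lagrangian_minimiser [where \<beta> = "\<beta> i"] pos z0 \<beta> zs) auto
    have L: "(\<Sum>i=1..n. ?L z i) = ?F z + (\<Sum>i=1..n. \<xi> i * z i) / \<mu>\<^sup>2" for z
      by (simp add: alloc_objective_def sum.distrib sum_divide_distrib)
    have "(\<Sum>i=1..n. ?L zs i) < (\<Sum>i=1..n. ?L z i)"
    proof (rule sum_strict_mono_ex1)
      show "\<forall>i\<in>{1..n}. ?L zs i \<le> ?L z i"
        using lt by (metis less_eq_real_def)
      show "\<exists>i\<in>{1..n}. ?L zs i < ?L z i"
        using lt k by blast
    qed simp
    moreover have "(\<Sum>i=1..n. \<xi> i * z i) / \<mu>\<^sup>2 \<le> P / \<mu>\<^sup>2"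
      using z by (intro divide_right_mono) (auto simp: alloc_feasible_def)
    ultimately show ?thesis
      unfolding L P by linarith
  qed
  show ?thesis
  proof
    assume "is_arg_min ?F (alloc_feasible n \<xi> P) z"
    thus "\<forall>i\<in>{1..n}. z i = zs i"
      using strict [of z] feas unfolding is_arg_min_def by blast
  next
    assume eq: "\<forall>i\<in>{1..n}. z i = zs i"
    hence "?F z = ?F zs" "alloc_feasible n \<xi> P z"
      using feas alloc_objective_cong [of n z zs a b] alloc_feasible_cong [of n z zs \<xi> P] by auto
    moreover have "\<not> ?F y < ?F zs" if "alloc_feasible n \<xi> P y" for y
      using strict [OF that] alloc_objective_cong [of n y zs a b] by fastforce
    ultimately show "is_arg_min ?F (alloc_feasible n \<xi> P) z"
      by (simp add: is_arg_min_def)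
  qed
qed

section \<open>The switch index and the water level\<close>

text \<open>Here \<open>c i\<close> stands for \<open>sqrt (a i * b i * \<xi> i)\<close>. Since
  \<open>\<beta> i * c i = b i * \<xi> i\<close>, the ratio \<open>f\<close> can be written in
  \<open>\<beta>\<close> and \<open>c\<close> alone. A channel with
  \<open>\<beta> j \<le> \<mu>\<close> spends the power \<open>c j * (\<mu> - \<beta> j)\<close> at
  level \<open>\<mu>\<close>.\<close>

locale threshold =
  fixes n :: nat and c \<beta> f :: "nat \<Rightarrow> real" and P :: real
  assumes n: "n \<ge> 1" and P: "P > 0"
    and c: "\<And>i. i \<in> {1..n} \<Longrightarrow> c i > 0"
    and \<beta>: "\<And>i. i \<in> {1..n} \<Longrightarrow> \<beta> i > 0"
    and mono: "mono_on {1..n} \<beta>"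
    and f: "\<And>i. i \<in> {1..n} \<Longrightarrow> f i = \<beta> i * (\<Sum>j=1..i. c j) / (P + (\<Sum>j=1..i. \<beta> j * c j))"
begin

text \<open>Clearing the positive denominator exhibits the power that the first \<open>i\<close>
  channels spend at level \<open>\<beta> i\<close>, to be compared with the budget.\<close>

lemma f_less_1_iff:
  assumes "i \<in> {1..n}"
  shows "f i < 1 \<longleftrightarrow> (\<Sum>j=1..i. c j * (\<beta> i - \<beta> j)) < P"
proof -
  have "(\<Sum>j=1..i. \<beta> j * c j) \<ge> 0"
    using assms c \<beta> by (intro sum_nonneg mult_nonneg_nonneg) (auto intro: less_imp_le)
  moreover have "(\<Sum>j=1..i. c j * (\<beta> i - \<beta> j)) = \<beta> i * (\<Sum>j=1..i. c j) - (\<Sum>j=1..i. \<beta> j * c j)"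
    by (simp add: sum_distrib_left sum_subtractf algebra_simps)
  ultimately show ?thesis
    using P by (simp add: f [OF assms] pos_divide_less_eq) linarith
qed

text \<open>Passing from \<open>k\<close> to \<open>i\<close> raises the level, which enlarges every
  summand, and adds further nonnegative summands.\<close>

lemma f_less_1_downward:
  assumes "f i < 1" "1 \<le> k" "k \<le> i" "i \<le> n"
  shows "f k < 1"
proof -
  have \<beta>_le: "\<beta> j \<le> \<beta> i" if "1 \<le> j" "j \<le> i" "i \<le> n" for i j
    using mono that by (auto simp: mono_on_def)
  have "(\<Sum>j=1..k. c j * (\<beta> k - \<beta> j)) \<le> (\<Sum>j=1..k. c j * (\<beta> i - \<beta> j))"
    using assms \<beta>_le c by (intro sum_mono mult_left_mono) (auto intro: less_imp_le)
  also have "\<dots> \<le> (\<Sum>j=1..i. c j * (\<beta> i - \<beta> j))"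
    using assms \<beta>_le c by (intro sum_mono2 mult_nonneg_nonneg) (auto intro: less_imp_le)
  also have "\<dots> < P"
    using f_less_1_iff assms by simp
  finally show ?thesis
    using f_less_1_iff assms by simp
qed

lemma ex1_switch_index:
  assumes "f n \<ge> 1"
  shows "\<exists>!i. is_switch_index n f i"
proof -
  \<comment> \<open>For index 1 the spent power is
    \<open>c 1 * (\<beta> 1 - \<beta> 1) = 0\<close>.\<close>
  have f1: "f 1 < 1"
    using f_less_1_iff [of 1] n P by simp
  \<comment> \<open>The switch index is the predecessor of the first index at which \<open>f\<close>
    reaches 1; as \<open>f 1 < 1\<close>, this predecessor is at least 1.\<close>
  define k where "k = (LEAST k. k \<ge> 1 \<and> f k \<ge> 1)"
  have k: "k \<ge> 1" "f k \<ge> 1" "k \<le> n"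
    using LeastI [of "\<lambda>k. k \<ge> 1 \<and> f k \<ge> 1" n] Least_le [of "\<lambda>k. k \<ge> 1 \<and> f k \<ge> 1" n] assms n
    by (auto simp: k_def)
  have below: "f j < 1" if "1 \<le> j" "j < k" for j
    using not_less_Least [of j "\<lambda>k. k \<ge> 1 \<and> f k \<ge> 1"] that by (auto simp: k_def)
  have "k \<noteq> 1"
    using f1 k by auto
  hence "is_switch_index n f (k - 1)"
    using k below [of "k - 1"] by (auto simp: is_switch_index_def)
  moreover have "i = j" if "is_switch_index n f i" "is_switch_index n f j" for i j
  proof -
    \<comment> \<open>If \<open>i < j\<close>, then \<open>f j < 1\<close> would propagate down to
      \<open>i + 1\<close>, where \<open>f\<close> is at least 1.\<close>
    have "\<not> i < j" if "is_switch_index n f i" "is_switch_index n f j" for i j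
      using that f_less_1_downward [of j "i + 1"] by (auto simp: is_switch_index_def)
    thus ?thesis
      using that by (meson linorder_neqE_nat)
  qed
  ultimately show ?thesis
    by blast
qed

text \<open>Both branches of \<open>active_set\<close> are brought into one form, the full set being
  the case \<open>m = n\<close>, where the last condition is vacuous.\<close>

lemma active_set_obtain:
  obtains m where "m \<in> {1..n}" "active_set n f = {1..m}" "f m < 1" "m < n \<longrightarrow> f (m + 1) \<ge> 1"
proof (cases "f n < 1")
  case True
  thus ?thesis
    using that [of n] n by (auto simp: active_set_def)
next
  case False
  hence "is_switch_index n f (THE i. is_switch_index n f i)"
    using theI' [OF ex1_switch_index] by simp
  moreover have "active_set n f = {1..(THE i. is_switch_index n f i)}"
    using False by (simp add: active_set_def)
  ultimately show ?thesis
    using that unfolding is_switch_index_def [of n f "THE i. _ i"] by auto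
qed

text \<open>This is the water level \<open>\<mu>\<close>: the solution of the linear equation saying
  that the active channels spend exactly \<open>P\<close>.\<close>

definition level :: real where
  "level = (P + (\<Sum>j\<in>active_set n f. \<beta> j * c j)) / (\<Sum>j\<in>active_set n f. c j)"

lemma active_set_subset: "active_set n f \<subseteq> {1..n}"
  by (rule active_set_obtain) auto

lemma sum_active_pos: "(\<Sum>j\<in>active_set n f. c j) > 0"
proof (rule active_set_obtain)
  fix m assume "m \<in> {1..n}" "active_set n f = {1..m}"
  thus ?thesis
    using c by (auto intro!: sum_pos)
qed

lemma level_eq: "(\<Sum>j\<in>active_set n f. c j * (level - \<beta> j)) = P"
proof -
  have "(\<Sum>j\<in>active_set n f. c j * (level - \<beta> j)) =
      (\<Sum>j\<in>active_set n f. c j) * level - (\<Sum>j\<in>active_set n f. \<beta> j * c j)"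
    by (simp add: right_diff_distrib sum_subtractf sum_distrib_right mult.commute [of "\<beta> _"])
  thus ?thesis
    using sum_active_pos by (simp add: level_def)
qed

text \<open>The power spent by the active channels is affine in the level, with positive slope, and
  equals \<open>P\<close> at \<open>level\<close>. Its comparison with \<open>P\<close> at
  \<open>\<beta> m\<close> and at \<open>\<beta> (m + 1)\<close> thus locates these two relative to
  \<open>level\<close>, and monotonicity settles all other indices.\<close>

lemma beta_less_level_iff:
  assumes i: "i \<in> {1..n}"
  shows "\<beta> i < level \<longleftrightarrow> i \<in> active_set n f"
proof -
  obtain m where m: "m \<in> {1..n}" "active_set n f = {1..m}" "f m < 1" "m < n \<longrightarrow> f (m + 1) \<ge> 1"
    by (rule active_set_obtain)
  have \<beta>_le: "\<beta> j \<le> \<beta> i" if "1 \<le> j" "j \<le> i" "i \<le> n" for i j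
    using mono that by (auto simp: mono_on_def)
  have diff: "(\<Sum>j=1..m. c j * (x - \<beta> j)) - P = (\<Sum>j=1..m. c j) * (x - level)" for x
    using level_eq unfolding m(2) by (simp add: right_diff_distrib sum_subtractf flip: sum_distrib_right)
  have C: "(\<Sum>j=1..m. c j) > 0"
    using sum_active_pos m(2) by simp
  show ?thesis
  proof (cases "i \<le> m")
    case True
    have "(\<Sum>j=1..m. c j) * (\<beta> m - level) < 0"
      using diff [of "\<beta> m"] m f_less_1_iff by simp
    hence "\<beta> m < level"
      using C by (simp add: mult_less_0_iff)
    thus ?thesis
      using \<beta>_le [of i m] True i m by auto
  next
    case False
    hence mn: "m + 1 \<in> {1..n}"
      using i by auto
    \<comment> \<open>At level \<open>\<beta> (m + 1)\<close> the summand of index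
      \<open>m + 1\<close> is zero, so the sum up to \<open>m + 1\<close> from
      \<open>f_less_1_iff\<close> equals the sum up to \<open>m\<close>.\<close>
    have "(\<Sum>j=1..m. c j) * (\<beta> (m + 1) - level) \<ge> 0"
      using diff [of "\<beta> (m + 1)"] m mn f_less_1_iff [OF mn] by simp
    hence "\<beta> (m + 1) \<ge> level"
      using C by (simp add: zero_le_mult_iff)
    moreover have "\<beta> (m + 1) \<le> \<beta> i"
      using \<beta>_le [of "m + 1" i] False i by auto
    ultimately show ?thesis
      using False m by auto
  qed
qed

lemma level_pos: "level > 0"
proof -
  have "(\<Sum>j\<in>active_set n f. \<beta> j * c j) \<ge> 0"
    using active_set_subset c \<beta> by (intro sum_nonneg mult_nonneg_nonneg) (auto intro!: less_imp_le)
  thus ?thesis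
    using P sum_active_pos by (simp add: level_def add_pos_nonneg)
qed

end

section \<open>Optimal gains in terms of the channel parameters\<close>

theorem mainTheorem3:
  fixes n :: nat
    and \<gamma> \<kappa> \<xi> a b \<beta> f :: "nat \<Rightarrow> real"
    and h :: "nat \<Rightarrow> complex"
    and \<sigma>\<^sub>n \<sigma>\<^sub>v s P \<pi>\<^sub>1 \<eta> :: real
    and S\<^sub>0 :: "nat set"
  assumes n: "n \<ge> 1"
    and gamma_pos: "\<forall>i\<in>{1..n}. \<gamma> i > 0"
    and h_nz: "\<forall>i\<in>{1..n}. h i \<noteq> 0"
    and var_n: "\<sigma>\<^sub>n\<^sup>2 > 0"
    and var_v: "\<sigma>\<^sub>v\<^sup>2 > 0"
    and s_pos: "s > 0"
    and s_eq: "s\<^sup>2 = \<sigma>\<^sub>v\<^sup>2 / \<sigma>\<^sub>n ^ 4"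
    and P_pos: "P > 0"
    and pi1_eq: "\<pi>\<^sub>1 = 1 / 2"
    and xi_eq: "\<xi> = (\<lambda>i. (1 + 2 * \<pi>\<^sub>1 * \<gamma> i) * \<sigma>\<^sub>n ^ 4)"
    and kappa_pos: "\<forall>i\<in>{1..n}. \<kappa> i > 0"
    and a_eq: "a = (\<lambda>i. \<kappa> i * (\<gamma> i)\<^sup>2)"
    and b_eq: "b = (\<lambda>i. \<kappa> i * s\<^sup>2 / (cmod (h i))\<^sup>2)"
    and beta_eq: "\<beta> = (\<lambda>i. sqrt (b i * \<xi> i / a i))"
    and f_eq: "f = (\<lambda>i. \<beta> i * (\<Sum>j=1..i. sqrt (a j * b j * \<xi> j)) / (P + (\<Sum>j=1..i. b j * \<xi> j)))"
    and S0_eq: "S\<^sub>0 = active_set n f"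
    and eta_eq: "\<eta> = ((\<Sum>i\<in>S\<^sub>0. \<kappa> i * \<xi> i / (cmod (h i))\<^sup>2) + P / s\<^sup>2)
                     / (\<Sum>i\<in>S\<^sub>0. \<kappa> i * sqrt (\<xi> i) * \<gamma> i / cmod (h i))"
  shows "(\<forall>g. (\<forall>i\<in>{1..n}. g i \<ge> 0) \<longrightarrow>
            (gain_feasible n \<xi> P g \<longleftrightarrow> alloc_feasible n \<xi> P (\<lambda>i. (g i)\<^sup>2)) \<and>
            (is_arg_min (error_prob n \<gamma> h s \<kappa>) (gain_feasible n \<xi> P) g \<longleftrightarrow>
             is_arg_min (alloc_objective n a b) (alloc_feasible n \<xi> P) (\<lambda>i. (g i)\<^sup>2)))
       \<and> (mono_on {1..n} \<beta> \<longrightarrow>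
            (f n \<ge> 1 \<longrightarrow> (\<exists>!i. is_switch_index n f i)) \<and>
            (\<forall>g. is_arg_min (error_prob n \<gamma> h s \<kappa>) (gain_feasible n \<xi> P) g \<longleftrightarrow>
               (\<forall>i\<in>{1..n}. g i =
                  (if i \<in> S\<^sub>0
                   then sqrt (\<kappa> i * s\<^sup>2 / (cmod (h i))\<^sup>2 * (\<gamma> i * cmod (h i) / sqrt (\<xi> i) * \<eta> - 1))
                   else 0))))"
proof -
  have \<sigma>4: "\<sigma>\<^sub>n ^ 4 > 0"
    using var_n by (simp add: zero_less_power_eq_numeral)
  have H: "cmod (h i) > 0" and \<gamma>: "\<gamma> i > 0" and \<kappa>: "\<kappa> i > 0" if "i \<in> {1..n}" for i
    using that h_nz gamma_pos kappa_pos by auto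
  have \<xi>: "\<xi> i > 0" if "i \<in> {1..n}" for i
    using \<sigma>4 \<gamma> [OF that] by (simp add: xi_eq pi1_eq)
  have a: "a i > 0" and b: "b i > 0" if "i \<in> {1..n}" for i
    using H [OF that] \<gamma> [OF that] \<kappa> [OF that] s_pos by (auto simp: a_eq b_eq)
  have \<beta>_alt: "\<beta> i = s * sqrt (\<xi> i) / (cmod (h i) * \<gamma> i)" if "i \<in> {1..n}" for i
  proof (unfold beta_eq, rule real_sqrt_unique)
    show "(s * sqrt (\<xi> i) / (cmod (h i) * \<gamma> i))\<^sup>2 = b i * \<xi> i / a i"
      using H [OF that] \<gamma> [OF that] \<kappa> [OF that] \<xi> [OF that]
      by (simp add: a_eq b_eq power_mult_distrib power_divide)
    show "0 \<le> s * sqrt (\<xi> i) / (cmod (h i) * \<gamma> i)"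
      using H [OF that] \<gamma> [OF that] \<xi> [OF that] s_pos by simp
  qed
  have \<beta>_pos: "\<beta> i > 0" if "i \<in> {1..n}" for i
    using H [OF that] \<gamma> [OF that] \<xi> [OF that] s_pos by (simp add: \<beta>_alt [OF that])
  define c where "c = (\<lambda>i. sqrt (a i * b i * \<xi> i))"
  have c_alt: "c i = s * (\<kappa> i * sqrt (\<xi> i) * \<gamma> i / cmod (h i))" if "i \<in> {1..n}" for i
  proof (unfold c_def, rule real_sqrt_unique)
    show "(s * (\<kappa> i * sqrt (\<xi> i) * \<gamma> i / cmod (h i)))\<^sup>2 = a i * b i * \<xi> i"
      using \<xi> [OF that] by (simp add: a_eq b_eq power_mult_distrib power_divide power2_eq_square)
    show "0 \<le> s * (\<kappa> i * sqrt (\<xi> i) * \<gamma> i / cmod (h i))"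
      using H [OF that] \<gamma> [OF that] \<kappa> [OF that] \<xi> [OF that] s_pos by simp
  qed
  have c: "c i > 0" if "i \<in> {1..n}" for i
    using a [OF that] b [OF that] \<xi> [OF that] by (simp add: c_def)
  \<comment> \<open>This identity turns the denominator of \<open>f\<close> into the form used by
    the locale \<open>threshold\<close>.\<close>
  have \<beta>c: "\<beta> i * c i = b i * \<xi> i" if "i \<in> {1..n}" for i
    using H [OF that] \<gamma> [OF that] \<kappa> [OF that] \<xi> [OF that]
    by (simp add: \<beta>_alt [OF that] c_alt [OF that] b_eq field_simps power2_eq_square)
  have transfer: "is_arg_min (error_prob n \<gamma> h s \<kappa>) (gain_feasible n \<xi> P) g \<longleftrightarrow>
      is_arg_min (alloc_objective n a b) (alloc_feasible n \<xi> P) (\<lambda>i. (g i)\<^sup>2)"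
    if "\<forall>i\<in>{1..n}. g i \<ge> 0" for g
    by (rule is_arg_min_error_prob_iff [OF kappa_pos h_nz s_pos a_eq b_eq that])
  show ?thesis
  proof (intro conjI allI impI)
    fix g :: "nat \<Rightarrow> real" assume g: "\<forall>i\<in>{1..n}. 0 \<le> g i"
    show "gain_feasible n \<xi> P g \<longleftrightarrow> alloc_feasible n \<xi> P (\<lambda>i. (g i)\<^sup>2)"
      using g by (simp add: gain_feasible_iff)
    show "is_arg_min (error_prob n \<gamma> h s \<kappa>) (gain_feasible n \<xi> P) g \<longleftrightarrow>
      is_arg_min (alloc_objective n a b) (alloc_feasible n \<xi> P) (\<lambda>i. (g i)\<^sup>2)"
      by (rule transfer [OF g])
  next
    assume mono: "mono_on {1..n} \<beta>"
    interpret threshold n c \<beta> f P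
    proof
      fix i assume i: "i \<in> {1..n}"
      have "(\<Sum>j=1..i. b j * \<xi> j) = (\<Sum>j=1..i. \<beta> j * c j)"
        using i \<beta>c by (intro sum.cong) auto
      thus "f i = \<beta> i * (\<Sum>j=1..i. c j) / (P + (\<Sum>j=1..i. \<beta> j * c j))"
        by (simp add: f_eq c_def)
    qed (use n P_pos c \<beta>_pos mono in auto)
    show "\<exists>!i. is_switch_index n f i" if "f n \<ge> 1"
      by (rule ex1_switch_index [OF that])
    fix g :: "nat \<Rightarrow> real"
    have S: "S\<^sub>0 \<subseteq> {1..n}"
      using active_set_subset by (simp add: S0_eq)
    \<comment> \<open>In the quotient defining \<open>level\<close>, the numerator carries a factor
      \<open>s\<^sup>2\<close> and the denominator a factor \<open>s\<close>.\<close>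
    have lev: "level = s * \<eta>"
    proof -
      have "(\<Sum>i\<in>S\<^sub>0. c i) = s * (\<Sum>i\<in>S\<^sub>0. \<kappa> i * sqrt (\<xi> i) * \<gamma> i / cmod (h i))"
        unfolding sum_distrib_left using S c_alt by (intro sum.cong) auto
      moreover have "P + (\<Sum>i\<in>S\<^sub>0. \<beta> i * c i) = s\<^sup>2 * ((\<Sum>i\<in>S\<^sub>0. \<kappa> i * \<xi> i / (cmod (h i))\<^sup>2) + P / s\<^sup>2)"
      proof -
        have "(\<Sum>i\<in>S\<^sub>0. \<beta> i * c i) = s\<^sup>2 * (\<Sum>i\<in>S\<^sub>0. \<kappa> i * \<xi> i / (cmod (h i))\<^sup>2)"
          unfolding sum_distrib_left using S \<beta>c by (intro sum.cong) (auto simp: b_eq)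
        thus ?thesis
          using s_pos by (simp add: distrib_left)
      qed
      ultimately show ?thesis
        using s_pos by (simp add: level_def eta_eq power2_eq_square flip: S0_eq)
    qed
    \<comment> \<open>These are the squares of the claimed gains.\<close>
    define w where "w = (\<lambda>i. if i \<in> S\<^sub>0
      then \<kappa> i * s\<^sup>2 / (cmod (h i))\<^sup>2 * (\<gamma> i * cmod (h i) / sqrt (\<xi> i) * \<eta> - 1) else 0)"
    have w_in: "w i = b i * (level / \<beta> i - 1)" if "i \<in> S\<^sub>0" for i
    proof -
      have i: "i \<in> {1..n}"
        using S that by auto
      have "level / \<beta> i = \<gamma> i * cmod (h i) / sqrt (\<xi> i) * \<eta>"
        using s_pos by (simp add: lev \<beta>_alt [OF i])
      thus ?thesis
        using that by (simp add: w_def b_eq)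
    qed
    \<comment> \<open>Membership in the active set decides the sign of
      \<open>level / \<beta> i - 1\<close>, so cutting off by the set agrees with truncating at
      0.\<close>
    have w_max: "w i = max 0 (b i * (level / \<beta> i - 1))" if i: "i \<in> {1..n}" for i
    proof (cases "i \<in> S\<^sub>0")
      case True
      hence "\<beta> i < level"
        using beta_less_level_iff [OF i] by (simp add: S0_eq)
      hence "b i * (level / \<beta> i - 1) \<ge> 0"
        using b [OF i] \<beta>_pos [OF i] by simp
      thus ?thesis
        by (simp add: w_in [OF True])
    next
      case False
      hence "\<not> \<beta> i < level"
        using beta_less_level_iff [OF i] by (simp add: S0_eq)
      hence "b i * (level / \<beta> i - 1) \<le> 0"
        using b [OF i] \<beta>_pos [OF i] by (simp add: mult_le_0_iff)
      thus ?thesis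
        using False by (simp add: w_def)
    qed
    have "(\<Sum>i=1..n. \<xi> i * w i) = (\<Sum>i\<in>S\<^sub>0. \<xi> i * w i)"
      using S by (intro sum.mono_neutral_right) (auto simp: w_def)
    also have "\<dots> = (\<Sum>i\<in>S\<^sub>0. c i * (level - \<beta> i))"
    proof (rule sum.cong)
      fix i assume "i \<in> S\<^sub>0"
      hence i: "i \<in> {1..n}"
        using S by auto
      have "\<xi> i * w i = b i * \<xi> i * (level / \<beta> i - 1)"
        by (simp add: w_in [OF \<open>i \<in> S\<^sub>0\<close>])
      also have "\<dots> = c i * (level - \<beta> i)"
        using \<beta>_pos [OF i] unfolding \<beta>c [OF i, symmetric] by (simp add: field_simps)
      finally show "\<xi> i * w i = c i * (level - \<beta> i)" .
    qed simp
    also have "\<dots> = P"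
      using level_eq by (simp add: S0_eq)
    finally have spent: "(\<Sum>i=1..n. \<xi> i * w i) = P" .
    have \<beta>_def: "\<beta> i = sqrt (b i * \<xi> i / a i)" for i
      by (simp add: beta_eq)
    have opt: "is_arg_min (alloc_objective n a b) (alloc_feasible n \<xi> P) z \<longleftrightarrow>
        (\<forall>i\<in>{1..n}. z i = w i)" for z
      by (rule alloc_minimiser_iff [OF a b \<xi> level_pos \<beta>_def w_max spent])
    have w0: "w i \<ge> 0" if "i \<in> {1..n}" for i
      by (simp add: w_max [OF that])
    \<comment> \<open>Powers do not see the sign of a gain, so \<open>transfer\<close> requires
      nonnegative gains; on the left this is part of feasibility.\<close>
    have "is_arg_min (error_prob n \<gamma> h s \<kappa>) (gain_feasible n \<xi> P) g \<longleftrightarrow>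
        (\<forall>i\<in>{1..n}. g i \<ge> 0) \<and> (\<forall>i\<in>{1..n}. (g i)\<^sup>2 = w i)"
      using transfer [of g] opt [of "\<lambda>i. (g i)\<^sup>2"]
      by (auto simp: is_arg_min_def gain_feasible_iff)
    also have "\<dots> \<longleftrightarrow> (\<forall>i\<in>{1..n}. g i = sqrt (w i))"
      using w0 by (metis real_sqrt_ge_zero real_sqrt_pow2 real_sqrt_unique)
    also have "\<dots> \<longleftrightarrow> (\<forall>i\<in>{1..n}. g i =
                  (if i \<in> S\<^sub>0
                   then sqrt (\<kappa> i * s\<^sup>2 / (cmod (h i))\<^sup>2 * (\<gamma> i * cmod (h i) / sqrt (\<xi> i) * \<eta> - 1))
                   else 0))"
      by (intro ball_cong refl) (simp add: w_def)
    finally show "is_arg_min (error_prob n \<gamma> h s \<kappa>) (gain_feasible n \<xi> P) g \<longleftrightarrow>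
               (\<forall>i\<in>{1..n}. g i =
                  (if i \<in> S\<^sub>0
                   then sqrt (\<kappa> i * s\<^sup>2 / (cmod (h i))\<^sup>2 * (\<gamma> i * cmod (h i) / sqrt (\<xi> i) * \<eta> - 1))
                   else 0))" .
  qed
qed

end
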